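(* Let $a$ be a positive integer with $a\equiv 3\pmod{4}$, and let $m$ be the smallest positive integer such that $\frac{a+1}{m}$ is the sum of two squares. Suppose $n$ is an odd positive integer such that $a^{n}+1$ is a sum of two squares. Then: (i) $\frac{n}{m}$ is a sum of two squares (in particular $m\mid n$); (ii) $a^{m}+1$ is the sum of two squares; (iii) if $\delta$ is a positive integer such that $\delta \mid \frac{n}{m}$ and $\delta$ is the sum of two squares, then $a^{m\delta}+1$ is the sum of two squares; (iv) moreover, if $a^{np^{2}}+1$ is the sum of two squares for some prime $p\equiv 3\pmod{4}$, then $p\mid a^{n}+1$.
   Context: A number $N$ is "the sum of two squares" if $N = s^2+t^2$ for some integers $s,t$ (zero is allowed); in particular $\frac{a+1}{m}$ must be an integer. *)

theory Defs
  imports "HOL-Number_Theory.Number_Theory"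
begin

(* Stated on the rationals so that it applies literally to quotients such as (a + 1) / m;
   integrality of the quotient is then part of the predicate. *)
definition sum_of_two_squares :: "rat \<Rightarrow> bool" where
  "sum_of_two_squares N \<longleftrightarrow> (\<exists>s t :: int. N = of_int (s\<^sup>2 + t\<^sup>2))"

end

theory Submission
  imports Defs "HOL-Library.Discrete_Functions"
begin

text \<open>
By the two squares theorem everything is decided by the parity of the multiplicities
\<open>v q x\<close> of the primes \<open>q\<close> congruent to 3 modulo 4; call these primes inert. For odd \<open>n\<close> and an inert prime
\<open>q\<close> dividing \<open>a + 1\<close>, lifting the exponent (lemma \<open>multiplicity_power_plus_one\<close>) gives
\<open>v q (a ^ n + 1) = v q (a + 1) + v q n\<close>. So if \<open>a ^ n + 1\<close> is a sum of two squares, then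
\<open>v q n\<close> and \<open>v q (a + 1)\<close> have the same parity.

The substance is that this parity also agrees at the inert primes \<open>q\<close> that do not divide
\<open>a + 1\<close>, that is, that \<open>v q n\<close> is even there. For \<open>b\<close> congruent to 3 modulo 4, write
\<open>b ^ p + 1 = (b + 1) * C\<close> with \<open>p\<close> inert and not dividing \<open>b + 1\<close>. As \<open>b\<close> is \<open>-1\<close> modulo 4, the
cofactor \<open>C\<close> is congruent to \<open>p\<close>, hence to 3, modulo 4, and some inert prime \<open>q\<close> divides it to an odd
power. This \<open>q\<close> does not divide \<open>b + 1\<close>, so \<open>b\<close> has order divisible by \<open>p\<close> modulo \<open>q\<close>, which forces
\<open>q > p\<close> (lemma \<open>ex_larger_prime_odd_multiplicity\<close>). Now let \<open>p\<close> be the largest inert prime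
that does not divide \<open>a + 1\<close> and has \<open>v p n\<close> odd. Since \<open>v q (a ^ n + 1)\<close> is even while
\<open>v q (a ^ p + 1)\<close> is odd, lifting the exponent from \<open>p\<close> to \<open>n\<close> shows that \<open>v q n\<close> is odd,
contradicting the choice of \<open>p\<close>.

By minimality \<open>m\<close> is a product of distinct inert primes, and its multiplicities at inert
primes have the same parity as those of \<open>a + 1\<close>, hence as those of \<open>n\<close>. This yields that \<open>m\<close> divides \<open>n\<close> and that
\<open>n div m\<close> is a sum of two squares. Passing from exponent \<open>n\<close> down to \<open>m * \<delta>\<close> changes the
multiplicity of an inert prime that divides \<open>a ^ (m * \<delta>) + 1\<close> by its multiplicity in
\<open>n div (m * \<delta>)\<close>, which is even. Finally, in
the last claim, if \<open>p\<close> did not divide \<open>a ^ n + 1\<close>, the prime \<open>q > p\<close> obtained for \<open>b = a ^ n\<close> would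
still have odd multiplicity in \<open>b ^ (p * p) + 1\<close>.
\<close>

section \<open>Sums of two squares over the natural numbers\<close>

text \<open>
The rational predicate is transferred to natural numbers, where multiplicities live.
\<close>

definition two_squares :: "nat \<Rightarrow> bool" where
  "two_squares n \<longleftrightarrow> (\<exists>s t. n = s\<^sup>2 + t\<^sup>2)"

lemma two_squares_iff_int: "two_squares n \<longleftrightarrow> (\<exists>s t :: int. int n = s\<^sup>2 + t\<^sup>2)"
proof
  assume "two_squares n"
  then obtain s t where "n = s\<^sup>2 + t\<^sup>2" unfolding two_squares_def by blast
  then have "int n = (int s)\<^sup>2 + (int t)\<^sup>2" by simp
  then show "\<exists>s t :: int. int n = s\<^sup>2 + t\<^sup>2" by blast
next
  assume "\<exists>s t :: int. int n = s\<^sup>2 + t\<^sup>2"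
  then obtain s t :: int where "int n = s\<^sup>2 + t\<^sup>2" by blast
  then have "int n = int ((nat \<bar>s\<bar>)\<^sup>2 + (nat \<bar>t\<bar>)\<^sup>2)" by simp
  then have "n = (nat \<bar>s\<bar>)\<^sup>2 + (nat \<bar>t\<bar>)\<^sup>2" by (rule int_int_eq[THEN iffD1])
  then show "two_squares n" unfolding two_squares_def by blast
qed

lemma sum_of_two_squares_divide_iff:
  fixes x k :: nat
  assumes "k > 0"
  shows "sum_of_two_squares (of_nat x / of_nat k) \<longleftrightarrow> k dvd x \<and> two_squares (x div k)"
proof
  assume "sum_of_two_squares (of_nat x / of_nat k)"
  then obtain s t :: int where st: "(of_nat x / of_nat k :: rat) = of_int (s\<^sup>2 + t\<^sup>2)"
    unfolding sum_of_two_squares_def by blast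
  define N where "N = nat (s\<^sup>2 + t\<^sup>2)"
  have N: "int N = s\<^sup>2 + t\<^sup>2" unfolding N_def by simp
  have "(of_nat x :: rat) = of_nat k * of_int (int N)"
    using st assms unfolding N by (simp add: field_simps)
  then have "(of_nat x :: rat) = of_nat (k * N)" by simp
  then have "x = k * N" by (rule of_nat_eq_iff[THEN iffD1])
  then show "k dvd x \<and> two_squares (x div k)"
    using assms N by (auto simp: two_squares_iff_int)
next
  assume R: "k dvd x \<and> two_squares (x div k)"
  then obtain N where x: "x = k * N" by blast
  then have "two_squares N" using R assms by simp
  then obtain s t :: int where "int N = s\<^sup>2 + t\<^sup>2" unfolding two_squares_iff_int by blast
  then have "(of_nat x / of_nat k :: rat) = of_int (s\<^sup>2 + t\<^sup>2)"
    using x assms by (metis nonzero_mult_div_cancel_left of_int_of_nat_eq of_nat_0_less_iff of_nat_mult order_less_irrefl)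
  then show "sum_of_two_squares (of_nat x / of_nat k)"
    unfolding sum_of_two_squares_def by blast
qed

lemma sum_of_two_squares_of_nat_iff: "sum_of_two_squares (of_nat x) \<longleftrightarrow> two_squares x"
  using sum_of_two_squares_divide_iff[of 1 x] by simp

lemma two_squares_square: "two_squares (x\<^sup>2)"
  unfolding two_squares_def by (rule exI[of _ x], rule exI[of _ 0]) simp

lemma two_squares_mult:
  assumes "two_squares x" "two_squares y"
  shows "two_squares (x * y)"
proof -
  from assms obtain a b c d :: int where "int x = a\<^sup>2 + b\<^sup>2" "int y = c\<^sup>2 + d\<^sup>2"
    unfolding two_squares_iff_int by blast
  then have "int (x * y) = (a * c + b * d)\<^sup>2 + (a * d - b * c)\<^sup>2"
    by (simp add: power2_eq_square algebra_simps)
  then show ?thesis unfolding two_squares_iff_int by blast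
qed

section \<open>The two squares theorem\<close>

lemma two_squares_mod_4: "two_squares n \<Longrightarrow> n mod 4 \<noteq> 3"
proof -
  assume "two_squares n"
  then obtain s t where n: "n = s\<^sup>2 + t\<^sup>2" unfolding two_squares_def by blast
  have sq: "x\<^sup>2 mod 4 = 0 \<or> x\<^sup>2 mod 4 = 1" for x :: nat
  proof (cases "even x")
    case True
    then show ?thesis by (auto elim!: evenE simp: power2_eq_square)
  next
    case False
    then obtain k where "x = 2 * k + 1" by (blast elim: oddE)
    then have "x\<^sup>2 = 1 + (k * k + k) * 4" by (simp add: power2_eq_square algebra_simps)
    then have "x\<^sup>2 mod 4 = 1 mod 4" by (simp only: mod_mult_self1)
    then show ?thesis by simp
  qed
  have "n mod 4 = (s\<^sup>2 mod 4 + t\<^sup>2 mod 4) mod 4" unfolding n by (simp add: mod_add_eq)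
  then show ?thesis using sq[of s] sq[of t] by auto
qed

text \<open>
Thue's argument. Since \<open>p\<close> is 1 modulo 4, there is \<open>u\<close> with \<open>u\<^sup>2\<close> congruent to \<open>-1\<close>. The map
\<open>(x, y) \<mapsto> x - u * y\<close> on the square of side \<open>floor_sqrt p\<close> must collide modulo \<open>p\<close>, and the difference
\<open>(s, t)\<close> of two colliding points satisfies \<open>0 < s\<^sup>2 + t\<^sup>2 < 2 * p\<close> with \<open>s\<^sup>2 + t\<^sup>2\<close> divisible by \<open>p\<close>.
\<close>

lemma two_squares_prime:
  assumes p: "prime (p::nat)" and p1: "p mod 4 = 1"
  shows "two_squares p"
proof -
  have p2: "2 < p" using p p1 prime_ge_2_nat[of p] by (cases "p = 2") auto
  have m1: "[-1 \<noteq> 0] (mod int p)" "\<not> [-1 = 1] (mod int p)"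
    using p2 zdvd_not_zless[of 2 "int p"] by (auto simp: cong_iff_dvd_diff)
  have ev: "even ((p - 1) div 2)" using p1 by presburger
  have "QuadRes (int p) (-1)"
  proof (rule ccontr)
    assume "\<not> QuadRes (int p) (-1)"
    then have "Legendre (-1) (int p) = -1"
      using m1 unfolding Legendre_def by (auto simp: cong_def)
    then show False using euler_criterion[OF p p2, of "-1"] ev m1 by simp
  qed
  then obtain u where u: "int p dvd u\<^sup>2 + 1"
    unfolding QuadRes_def by (auto simp: cong_iff_dvd_diff)
  define K where "K = floor_sqrt p"
  have "K\<^sup>2 \<le> p" unfolding K_def by simp
  moreover have "K\<^sup>2 \<noteq> p"
    using p by (metis numeral_One numeral_eq_iff semiring_norm(83) prime_power_iff)
  ultimately have Kp: "K\<^sup>2 < p" by simp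
  have pK: "p < (K + 1)\<^sup>2" unfolding K_def using Suc_floor_sqrt_power2_gt by simp
  define A where "A = {0..int K} \<times> {0..int K}"
  define f where "f = (\<lambda>(x, y). (x - u * y) mod int p)"
  have "f ` A \<subseteq> {0..<int p}" unfolding f_def using p2 by auto
  then have "card (f ` A) \<le> p" using card_mono[of "{0..<int p}"] by fastforce
  moreover have "card A = (K + 1)\<^sup>2"
    unfolding A_def card_cartesian_product by (simp add: power2_eq_square nat_add_distrib)
  ultimately have "\<not> inj_on f A" using pK by (intro pigeonhole) simp
  then obtain x1 y1 x2 y2 where xy: "(x1, y1) \<in> A" "(x2, y2) \<in> A"
    "(x1, y1) \<noteq> (x2, y2)" "f (x1, y1) = f (x2, y2)"
    unfolding inj_on_def by auto
  define s t where "s = x1 - x2" and "t = y1 - y2"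
  have "int p dvd (x1 - u * y1) - (x2 - u * y2)"
    using xy(4) unfolding f_def by (simp add: mod_eq_dvd_iff)
  then have "int p dvd s - u * t" unfolding s_def t_def by (simp add: algebra_simps)
  then have "int p dvd (s - u * t) * (s + u * t) + (u\<^sup>2 + 1) * t\<^sup>2" using u by auto
  then have "int p dvd s\<^sup>2 + t\<^sup>2" by (simp add: power2_eq_square algebra_simps)
  then obtain c where c: "s\<^sup>2 + t\<^sup>2 = int p * c" by blast
  have "\<bar>s\<bar> \<le> int K" "\<bar>t\<bar> \<le> int K" using xy unfolding A_def s_def t_def by auto
  then have "s\<^sup>2 \<le> (int K)\<^sup>2" "t\<^sup>2 \<le> (int K)\<^sup>2" by (simp_all add: abs_le_square_iff[symmetric])
  moreover have "(int K)\<^sup>2 < int p" using Kp by (metis of_nat_less_iff of_nat_power)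
  ultimately have lt: "int p * c < int p * 2" using c by linarith
  have "s \<noteq> 0 \<or> t \<noteq> 0" using xy(3) unfolding s_def t_def by auto
  then have "0 < s\<^sup>2 + t\<^sup>2" by (simp add: sum_power2_gt_zero_iff)
  then have "0 < int p * c" using c by simp
  then have "0 < c" using p2 by (simp add: zero_less_mult_iff)
  moreover have "c < 2" using lt p2 by simp
  ultimately have "c = 1" by simp
  then show ?thesis using c unfolding two_squares_iff_int by (metis mult.right_neutral)
qed

text \<open>
Otherwise \<open>s\<^sup>2\<close> is congruent to \<open>- t\<^sup>2\<close> with both sides invertible; raising this to the power
\<open>(q - 1) div 2\<close>, which is odd, contradicts Fermat's little theorem.
\<close>

lemma prime_dvd_sum_squares:
  fixes q s t :: nat
  assumes q: "prime q" "q mod 4 = 3" and d: "q dvd s\<^sup>2 + t\<^sup>2"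
  shows "q dvd s \<and> q dvd t"
proof (rule ccontr)
  assume "\<not> (q dvd s \<and> q dvd t)"
  moreover have "q dvd s \<longleftrightarrow> q dvd t"
    using d q(1) by (metis dvd_add_right_iff dvd_add_left_iff prime_dvd_power_nat_iff zero_less_numeral)
  ultimately have nd: "\<not> q dvd s" "\<not> q dvd t" by auto
  define k where "k = (q - 1) div 2"
  have k: "odd k" "q - 1 = 2 * k" unfolding k_def using q(2) by presburger+
  have fs: "[x ^ (2 * k) = 1] (mod q)" if "\<not> q dvd x" for x
    using fermat_theorem[OF q(1) that] k by simp
  have 1: "[int s ^ (2 * k) = 1] (mod int q)" "[int t ^ (2 * k) = 1] (mod int q)"
    using fs[OF nd(1)] fs[OF nd(2)] by (metis cong_int_iff of_nat_1 of_nat_power)+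
  have "[(int s)\<^sup>2 = - ((int t)\<^sup>2)] (mod int q)"
    using d unfolding cong_iff_dvd_diff by (metis diff_minus_eq_add int_dvd_int_iff of_nat_add of_nat_power)
  then have "[((int s)\<^sup>2) ^ k = (- ((int t)\<^sup>2)) ^ k] (mod int q)" by (rule cong_pow)
  then have "[int s ^ (2 * k) = - (int t ^ (2 * k))] (mod int q)"
    using k(1) by (simp add: power_mult)
  then have "[1 = - (1::int)] (mod int q)"
    using 1 by (meson cong_minus_minus_iff cong_sym cong_trans)
  then have "int q dvd 2" by (simp add: cong_iff_dvd_diff)
  then have "q dvd 2" by (metis int_dvd_int_iff of_nat_numeral)
  then have "q \<le> 2" by (rule dvd_imp_le) simp
  then show False using q(2) by auto
qed

lemma two_squares_even_multiplicity:
  fixes n q :: nat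
  assumes "prime q" "q mod 4 = 3" "two_squares n"
  shows "even (multiplicity q n)"
  using assms(3)
proof (induction n rule: less_induct)
  case (less n)
  show ?case
  proof (cases "n = 0 \<or> \<not> q dvd n")
    case True
    then show ?thesis by (auto simp: not_dvd_imp_multiplicity_0)
  next
    case False
    from less.prems obtain s t where n: "n = s\<^sup>2 + t\<^sup>2" unfolding two_squares_def by blast
    then have "q dvd s\<^sup>2 + t\<^sup>2" using False by simp
    then have "q dvd s" "q dvd t" using prime_dvd_sum_squares[OF assms(1,2)] by blast+
    then obtain s' t' where "s = q * s'" "t = q * t'" unfolding dvd_def by blast
    then have n': "n = q\<^sup>2 * (s'\<^sup>2 + t'\<^sup>2)" using n by (simp add: power_mult_distrib algebra_simps)
    define n' where "n' = s'\<^sup>2 + t'\<^sup>2"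
    have nn: "n = q\<^sup>2 * n'" "two_squares n'" using n' unfolding n'_def two_squares_def by auto
    have pos: "n' > 0" using nn False by (cases n') auto
    have "q\<^sup>2 > 1" using prime_gt_1_nat[OF assms(1)] by (intro one_less_power) simp_all
    then have "n' < n" using nn pos by simp
    then have "even (multiplicity q n')" using less.IH nn by blast
    moreover have "multiplicity q n = 2 + multiplicity q n'"
      using nn pos assms(1)
      by (simp add: prime_elem_multiplicity_mult_distrib prime_elem_multiplicity_power_distrib)
    ultimately show ?thesis by simp
  qed
qed

text \<open>
Every \<open>n > 1\<close> splits off a factor that is a sum of two squares: a prime divisor \<open>p\<close>
itself if \<open>p\<close> is 2 or 1 modulo 4, and \<open>p\<^sup>2\<close> if \<open>p\<close> is 3 modulo 4. Both keep the parities at primes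
congruent to 3 modulo 4, so induction applies to the cofactor.
\<close>

lemma two_squares_if_even_multiplicity:
  fixes n :: nat
  assumes "n > 0" "\<And>q. prime q \<Longrightarrow> q mod 4 = 3 \<Longrightarrow> even (multiplicity q n)"
  shows "two_squares n"
  using assms
proof (induction n rule: less_induct)
  case (less n)
  show ?case
  proof (cases "n = 1")
    case True
    then show ?thesis using two_squares_square[of 1] by simp
  next
    case False
    then obtain p where p: "prime p" "p dvd n" using prime_factor_nat by blast
    define d where "d = (if p mod 4 = 3 then p\<^sup>2 else p)"
    have p1: "p > 1" using p prime_gt_1_nat by blast
    have d1: "d > 1" unfolding d_def using p1 one_less_power[of p 2] by simp
    have dts: "two_squares d"
    proof (cases "p mod 4 = 3")
      case True
      then show ?thesis unfolding d_def by (simp add: two_squares_square)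
    next
      case F: False
      show ?thesis
      proof (cases "p = 2")
        case True
        have "two_squares 2" unfolding two_squares_def by (rule exI[of _ 1], rule exI[of _ 1]) simp
        then show ?thesis using True unfolding d_def by simp
      next
        case False
        then have "odd p" using p p1 prime_odd_nat by auto
        then have "p mod 4 = 1" using F by presburger
        then show ?thesis using two_squares_prime p F unfolding d_def by simp
      qed
    qed
    have "d dvd n"
    proof (cases "p mod 4 = 3")
      case True
      then have "even (multiplicity p n)" using less.prems p by blast
      moreover have "multiplicity p n \<noteq> 0"
        using p less.prems(1) by (simp add: prime_multiplicity_gt_zero_iff)
      ultimately have "2 \<le> multiplicity p n" by presburger
      then show ?thesis using True unfolding d_def by (simp add: multiplicity_dvd')
    next
      case False
      then show ?thesis using p unfolding d_def by simp
    qed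
    then obtain n' where n: "n = d * n'" by blast
    have n'0: "n' > 0" using n less.prems(1) by (cases n') auto
    have "two_squares n'"
    proof (rule less.IH)
      show "n' < n" using n d1 n'0 by simp
      show "n' > 0" by fact
      fix q :: nat assume q: "prime q" "q mod 4 = 3"
      have "multiplicity q n = multiplicity q d + multiplicity q n'"
        unfolding n using q d1 n'0 by (intro prime_elem_multiplicity_mult_distrib) auto
      then show "even (multiplicity q n')"
        using less.prems(2)[OF q] two_squares_even_multiplicity[OF q dts] by simp
    qed
    then show ?thesis using dts two_squares_mult n by simp
  qed
qed

text \<open>
With only even multiplicities \<open>n\<close> would be a sum of two squares, and those are never 3
modulo 4.
\<close>

lemma ex_odd_multiplicity_if_mod_4:
  fixes n :: nat
  assumes "n mod 4 = 3"
  shows "\<exists>q. prime q \<and> q mod 4 = 3 \<and> odd (multiplicity q n)"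
proof (rule ccontr)
  assume "\<not> ?thesis"
  moreover have "n > 0" using assms by (cases n) auto
  ultimately have "two_squares n" using two_squares_if_even_multiplicity by blast
  then show False using two_squares_mod_4 assms by blast
qed

lemma two_squares_cofactor:
  fixes x y :: nat
  assumes "x > 0" "y > 0" "two_squares (x * y)" "two_squares x"
  shows "two_squares y"
proof (rule two_squares_if_even_multiplicity)
  fix q :: nat assume q: "prime q" "q mod 4 = 3"
  have "multiplicity q (x * y) = multiplicity q x + multiplicity q y"
    using q assms(1,2) by (intro prime_elem_multiplicity_mult_distrib) auto
  then show "even (multiplicity q y)"
    using two_squares_even_multiplicity[OF q assms(3)] two_squares_even_multiplicity[OF q assms(4)]
    by simp
qed (rule assms(2))

section \<open>Lifting the exponent\<close>

lemma odd_power_plus_one_factor: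
  fixes b k :: nat
  assumes "odd k"
  obtains C where "b ^ k + 1 = (b + 1) * C" "int C = (\<Sum>i<k. (- int b) ^ i)"
proof -
  define S where "S = (\<Sum>i<k. (- int b) ^ i)"
  have "1 - (- int b) ^ k = (1 - (- int b)) * S"
    unfolding S_def by (rule one_diff_power_eq)
  then have S: "int b ^ k + 1 = (int b + 1) * S" using assms by (simp add: add.commute)
  have "0 < (int b + 1) * S" unfolding S[symmetric] by simp
  then have S0: "0 < S" by (simp add: zero_less_mult_iff)
  then have "int (b ^ k + 1) = int ((b + 1) * nat S)" using S by (simp add: algebra_simps)
  then have "b ^ k + 1 = (b + 1) * nat S" by (rule of_nat_eq_iff[THEN iffD1])
  then show thesis using S0 that unfolding S_def by simp
qed

lemma cofactor_cong:
  fixes b k C :: nat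
  assumes "int C = (\<Sum>i<k. (- int b) ^ i)" "q dvd b + 1"
  shows "[C = k] (mod q)"
proof -
  have "int q dvd int (b + 1)" using assms(2) by (rule int_dvd_int_iff[THEN iffD2])
  then have "[- int b = 1] (mod int q)"
    by (metis cong_iff_dvd_diff cong_sym diff_minus_eq_add add.commute of_nat_1 of_nat_add)
  then have "[(\<Sum>i<k. (- int b) ^ i) = (\<Sum>i<k. 1 ^ i)] (mod int q)"
    by (intro cong_sum cong_pow)
  then have "[int C = int k] (mod int q)" using assms(1) by simp
  then show ?thesis by (simp add: cong_int_iff)
qed

text \<open>
Writing \<open>b = -(1 - x)\<close> with \<open>q\<close> dividing \<open>x\<close>, the cofactor is \<open>\<Sum>i<q. (1 - x) ^ i\<close>, which modulo
\<open>q\<^sup>2\<close> equals \<open>q - x * (\<Sum>i<q. i)\<close>. Since \<open>q\<close> is odd, \<open>q\<close> divides \<open>\<Sum>i<q. i\<close>, so the cofactor is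
congruent to \<open>q\<close> modulo \<open>q\<^sup>2\<close> and contains \<open>q\<close> exactly once.
\<close>

lemma multiplicity_power_plus_one_same:
  fixes b q :: nat
  assumes q: "prime q" "odd q" and d: "q dvd b + 1"
  shows "multiplicity q (b ^ q + 1) = multiplicity q (b + 1) + 1"
proof -
  obtain C where C: "b ^ q + 1 = (b + 1) * C" "int C = (\<Sum>i<q. (- int b) ^ i)"
    using odd_power_plus_one_factor[OF q(2)] by blast
  from d obtain r where r: "b + 1 = q * r" by (rule dvdE)
  define x where "x = int q * int r"
  have x: "- int b = 1 - x" using arg_cong[OF r, of int] unfolding x_def by simp
  have bin: "[(1 - x) ^ i = 1 - int i * x] (mod (int q)\<^sup>2)" for i
  proof (induction i)
    case (Suc i)
    have "[(1 - x) * (1 - x) ^ i = (1 - x) * (1 - int i * x)] (mod (int q)\<^sup>2)"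
      using Suc by (rule cong_scalar_left)
    moreover have "[(1 - x) * (1 - int i * x) = 1 - int (Suc i) * x] (mod (int q)\<^sup>2)"
      unfolding cong_iff_dvd_diff x_def
      by (rule dvdI[of _ _ "int i * (int r)\<^sup>2"]) (simp add: algebra_simps power2_eq_square)
    ultimately show ?case using cong_trans by fastforce
  qed simp
  obtain h where h: "q = 2 * h + 1" using q(2) by (blast elim: oddE)
  have tri: "(\<Sum>i<2 * h + 1. int i) = int ((2 * h + 1) * h)" for h
    by (induction h) (simp_all add: algebra_simps)
  have "[int C = (\<Sum>i<q. 1 - int i * x)] (mod (int q)\<^sup>2)"
    unfolding C(2) x by (intro cong_sum bin)
  also have "(\<Sum>i<q. 1 - int i * x) = int q - int (q * h) * x"
    using tri[of h] h by (simp add: sum_subtractf sum_distrib_right[symmetric])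
  also have "[int q - int (q * h) * x = int q] (mod (int q)\<^sup>2)"
    unfolding cong_iff_dvd_diff x_def
    by (rule dvdI[of _ _ "- (int h * int r)"]) (simp add: algebra_simps power2_eq_square)
  finally have "[C = q] (mod q\<^sup>2)" by (metis cong_int_iff of_nat_power)
  have q1: "q > 1" using q prime_gt_1_nat by blast
  have "q ^ 1 dvd C" using \<open>[C = q] (mod q\<^sup>2)\<close>
    by (metis cong_dvd_iff cong_dvd_modulus_nat dvd_refl dvd_triv_left power2_eq_square power_one_right)
  moreover have "\<not> q ^ Suc 1 dvd C"
  proof
    assume "q ^ Suc 1 dvd C"
    then have "q\<^sup>2 dvd q" using \<open>[C = q] (mod q\<^sup>2)\<close> cong_dvd_iff[of C q "q\<^sup>2" ] 
      by (metis Suc_1 cong_0_iff cong_sym cong_trans)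
    then have "q\<^sup>2 \<le> q" using q1 by (intro dvd_imp_le) auto
    then show False using q1 by (simp add: power2_eq_square)
  qed
  ultimately have "multiplicity q C = 1" by (rule multiplicity_eqI)
  moreover have "C \<noteq> 0" using C(1) by (cases C) auto
  ultimately show ?thesis
    unfolding C(1) using q by (subst prime_elem_multiplicity_mult_distrib) auto
qed

text \<open>
Factors \<open>q\<close> of the exponent are removed one at a time, each contributing 1; for an exponent
prime to \<open>q\<close> the cofactor is congruent to it modulo \<open>q\<close> and contributes nothing.
\<close>

lemma multiplicity_power_plus_one:
  fixes b k q :: nat
  assumes q: "prime q" "odd q" and "odd k" and "q dvd b + 1"
  shows "multiplicity q (b ^ k + 1) = multiplicity q (b + 1) + multiplicity q k"
  using assms(3,4)
proof (induction k arbitrary: b rule: less_induct)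
  case (less k)
  have k0: "k > 0" using less.prems by (cases k) auto
  show ?case
  proof (cases "q dvd k")
    case False
    obtain C where C: "b ^ k + 1 = (b + 1) * C" "int C = (\<Sum>i<k. (- int b) ^ i)"
      using odd_power_plus_one_factor[OF less.prems(1)] by blast
    have "\<not> q dvd C" using cofactor_cong[OF C(2) less.prems(2)] False by (simp add: cong_dvd_iff)
    moreover have "C \<noteq> 0" using C(1) by (cases C) auto
    ultimately show ?thesis
      unfolding C(1) using q False
      by (subst prime_elem_multiplicity_mult_distrib) (auto simp: not_dvd_imp_multiplicity_0)
  next
    case True
    then obtain k' where k': "k = q * k'" by blast
    have "k' > 0" using k0 k' by (cases k') auto
    then have lt: "k' < k" using prime_gt_1_nat[OF q(1)] k' by simp
    have "q dvd b ^ q + 1"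
      using odd_power_plus_one_factor[OF q(2)] less.prems(2) by (metis dvd_mult2)
    then have "multiplicity q ((b ^ q) ^ k' + 1) = multiplicity q (b ^ q + 1) + multiplicity q k'"
      using less.IH[OF lt] less.prems(1) k' by simp
    moreover have "multiplicity q k = 1 + multiplicity q k'"
      unfolding k' using q \<open>k' > 0\<close> by (subst prime_elem_multiplicity_mult_distrib) auto
    ultimately show ?thesis
      using multiplicity_power_plus_one_same[OF q less.prems(2)] unfolding k' power_mult by simp
  qed
qed

lemma odd_if_mod_4: "q mod 4 = 3 \<Longrightarrow> odd (q::nat)"
  by presburger

lemma multiplicity_power_mult_plus_one:
  fixes a d e q :: nat
  assumes "prime q" "odd q" "odd e" "q dvd a ^ d + 1"
  shows "multiplicity q (a ^ (d * e) + 1) = multiplicity q (a ^ d + 1) + multiplicity q e"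
  using multiplicity_power_plus_one[OF assms] by (simp add: power_mult)

section \<open>New primes of odd multiplicity\<close>

text \<open>
The order of \<open>b\<close> modulo \<open>q\<close> divides both \<open>2 * p\<close> and \<open>q - 1\<close>. If \<open>p\<close> did not divide \<open>q - 1\<close>, the order
would divide 2, so \<open>b ^ p\<close> would be congruent to \<open>b\<close>, as \<open>p\<close> is odd, and \<open>q\<close> would divide \<open>b + 1\<close>.
\<close>

lemma less_of_prime_dvd_power_plus_one:
  fixes b p q :: nat
  assumes p: "prime p" "odd p" and q: "prime q"
    and d: "q dvd b ^ p + 1" and nd: "\<not> q dvd b + 1"
  shows "p < q"
proof -
  have "\<not> q dvd b"
  proof
    assume "q dvd b"
    then have "q dvd b ^ p" using prime_gt_0_nat[OF p(1)] by (simp add: dvd_power_le prime_dvd_power_nat_iff[OF q])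
    then have "q dvd 1" using d by (metis dvd_add_right_iff)
    then show False using q by simp
  qed
  then have "[b ^ (q - 1) = 1] (mod q)" using fermat_theorem q by blast
  then have o1: "ord q b dvd q - 1" using ord_divides by blast
  have "[int b ^ p = -1] (mod int q)"
    using d unfolding cong_iff_dvd_diff by (metis diff_minus_eq_add int_dvd_int_iff of_nat_1 of_nat_add of_nat_power)
  then have "[(int b ^ p) ^ 2 = (-1) ^ 2] (mod int q)" by (rule cong_pow)
  then have "[int (b ^ (p * 2)) = int 1] (mod int q)" by (simp add: power_mult)
  then have "[b ^ (p * 2) = 1] (mod q)" by (rule cong_int_iff[THEN iffD1])
  then have o2: "ord q b dvd p * 2" using ord_divides by blast
  have "p dvd q - 1"
  proof (rule ccontr)
    assume "\<not> p dvd q - 1"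
    then have "\<not> p dvd ord q b" using o1 dvd_trans by blast
    then have "coprime (ord q b) p" using p(1) by (simp add: prime_imp_coprime coprime_commute)
    then have "ord q b dvd 2" using o2 by (simp add: coprime_dvd_mult_right_iff)
    then have b2: "[b ^ 2 = 1] (mod q)" using ord_divides by blast
    obtain h where h: "p = 2 * h + 1" using p(2) by (blast elim: oddE)
    have "[(b ^ 2) ^ h * b + 1 = 1 ^ h * b + 1] (mod q)"
      using b2 by (intro cong_add cong_mult cong_pow) auto
    then have "[b ^ p + 1 = b + 1] (mod q)" unfolding h power_add power_mult by simp
    then show False using d nd by (simp add: cong_dvd_iff)
  qed
  then have "p \<le> q - 1" using prime_gt_1_nat[OF q] by (intro dvd_imp_le) auto
  then show ?thesis using prime_gt_1_nat[OF q] by simp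
qed

text \<open>
The prime \<open>q\<close> comes from the cofactor \<open>C\<close> of \<open>b + 1\<close> in \<open>b ^ p + 1\<close>, which is 3 modulo 4. It is not \<open>p\<close>,
because by Fermat \<open>p\<close> divides \<open>b ^ p + 1\<close> only if it divides \<open>b + 1\<close>. It does not divide \<open>b + 1\<close>
either, since modulo a divisor of \<open>b + 1\<close> the cofactor is congruent to \<open>p\<close>.
\<close>

lemma ex_larger_prime_odd_multiplicity:
  fixes b p :: nat
  assumes b: "b mod 4 = 3" and p: "prime p" "p mod 4 = 3" and nd: "\<not> p dvd b + 1"
  obtains q where "prime q" "q mod 4 = 3" "p < q" "\<not> q dvd b + 1"
    "odd (multiplicity q (b ^ p + 1))"
proof -
  have op: "odd p" using p odd_if_mod_4 by blast
  obtain C where C: "b ^ p + 1 = (b + 1) * C" "int C = (\<Sum>i<p. (- int b) ^ i)"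
    using odd_power_plus_one_factor[OF op] by blast
  have "4 dvd b + 1" using b by presburger
  then have "[C = p] (mod 4)" using cofactor_cong[OF C(2)] by blast
  then have "C mod 4 = 3" using p by (simp add: cong_def)
  then obtain q where q: "prime q" "q mod 4 = 3" "odd (multiplicity q C)"
    using ex_odd_multiplicity_if_mod_4 by blast
  have qC: "q dvd C" using q(3) not_dvd_imp_multiplicity_0[of q C] by force
  have qp: "q \<noteq> p"
  proof
    assume "q = p"
    then have "p dvd b ^ p + 1" using qC C(1) by simp
    moreover have "[b ^ p = b] (mod p)"
    proof (cases "p dvd b")
      case True
      then show ?thesis using prime_gt_0_nat[OF p(1)]
        by (simp add: cong_def mod_0_imp_dvd dvd_power_le prime_dvd_power_nat_iff[OF p(1)] dvd_imp_mod_0)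
    next
      case False
      have "[b ^ (p - 1) * b = 1 * b] (mod p)"
        using fermat_theorem[OF p(1) False] by (rule cong_scalar_right)
      then show ?thesis using prime_gt_0_nat[OF p(1)] by (metis mult_1 mult.commute power_minus_mult)
    qed
    then have "[b ^ p + 1 = b + 1] (mod p)" by (intro cong_add) auto
    ultimately show False using nd by (simp add: cong_dvd_iff)
  qed
  have nq: "\<not> q dvd b + 1"
  proof
    assume "q dvd b + 1"
    then have "q dvd p" using cofactor_cong[OF C(2)] qC by (metis cong_dvd_iff)
    then show False using qp p q primes_dvd_imp_eq by blast
  qed
  have "C \<noteq> 0" using C(1) by (cases C) auto
  then have "multiplicity q (b ^ p + 1) = multiplicity q C"
    unfolding C(1) using q nq
    by (subst prime_elem_multiplicity_mult_distrib) (auto simp: not_dvd_imp_multiplicity_0)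
  moreover have "p < q"
    using less_of_prime_dvd_power_plus_one[OF p(1) op q(1) _ nq] qC C(1) by simp
  ultimately show thesis using that q nq by simp
qed

text \<open>
The primes violating the claim form a finite set, but each of them produces a larger one.
\<close>

lemma even_multiplicity_exponent_if_not_dvd:
  fixes a n p :: nat
  assumes a: "a mod 4 = 3" and n: "odd n" and ts: "two_squares (a ^ n + 1)"
    and p: "prime p" "p mod 4 = 3" "\<not> p dvd a + 1"
  shows "even (multiplicity p n)"
proof (rule ccontr)
  define S where "S = {p. prime p \<and> p mod 4 = 3 \<and> \<not> p dvd a + 1 \<and> odd (multiplicity p n)}"
  assume "odd (multiplicity p n)"
  then have "S \<noteq> {}" unfolding S_def using p by blast
  have n0: "n > 0" using n by (cases n) auto
  have dvd: "p dvd n" if "p \<in> S" for p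
    using that not_dvd_imp_multiplicity_0[of p n] unfolding S_def by force
  then have "S \<subseteq> {..n}" using n0 by (auto intro: dvd_imp_le)
  then have fin: "finite S" using finite_subset by blast
  define r where "r = Max S"
  have "r \<in> S" unfolding r_def using fin \<open>S \<noteq> {}\<close> by (rule Max_in)
  then obtain q where q: "prime q" "q mod 4 = 3" "r < q" "\<not> q dvd a + 1"
    "odd (multiplicity q (a ^ r + 1))"
    using ex_larger_prime_odd_multiplicity[OF a] unfolding S_def by blast
  from dvd[OF \<open>r \<in> S\<close>] obtain e where e: "n = r * e" by blast
  have "odd e" using n e by simp
  have "q dvd a ^ r + 1" using q(5) not_dvd_imp_multiplicity_0[of q "a ^ r + 1"] by force
  then have "multiplicity q (a ^ n + 1) = multiplicity q (a ^ r + 1) + multiplicity q e"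
    unfolding e using q odd_if_mod_4 \<open>odd e\<close> by (intro multiplicity_power_mult_plus_one) auto
  then have "odd (multiplicity q e)"
    using two_squares_even_multiplicity[OF q(1,2) ts] q(5) by simp
  moreover have "multiplicity q n = multiplicity q r + multiplicity q e"
    unfolding e using q n0 e by (intro prime_elem_multiplicity_mult_distrib) auto
  moreover have "multiplicity q r = 0"
    using q(1,3) \<open>r \<in> S\<close> primes_dvd_imp_eq[of q r] unfolding S_def
    by (auto intro!: not_dvd_imp_multiplicity_0)
  \<comment> \<open>The multiplicity of \<open>q\<close> in \<open>n = r * e\<close> is therefore odd, although \<open>r\<close> is maximal in \<open>S\<close>.\<close>
  ultimately have "q \<in> S" unfolding S_def using q by simp
  then have "q \<le> r" unfolding r_def using fin by simp
  then show False using q(3) by simp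
qed

lemma multiplicity_exponent_parity:
  fixes a n q :: nat
  assumes a: "a mod 4 = 3" and n: "odd n" and ts: "two_squares (a ^ n + 1)"
    and q: "prime q" "q mod 4 = 3"
  shows "even (multiplicity q n) \<longleftrightarrow> even (multiplicity q (a + 1))"
proof (cases "q dvd a + 1")
  case True
  then show ?thesis
    using multiplicity_power_plus_one[OF q(1) odd_if_mod_4[OF q(2)] n True]
      two_squares_even_multiplicity[OF q ts] by simp
next
  case False
  then show ?thesis
    using even_multiplicity_exponent_if_not_dvd[OF a n ts q False]
    by (simp add: not_dvd_imp_multiplicity_0)
qed

section \<open>Consequences for the exponents\<close>

text \<open>
Raising from exponent \<open>n * p\<close> to \<open>n * p * p\<close> cannot repair the odd multiplicity of a prime
\<open>q > p\<close>, because \<open>q\<close> does not divide \<open>p\<close>.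
\<close>

lemma dvd_if_prime_square:
  fixes p a n :: nat
  assumes a: "a mod 4 = 3" and n: "odd n" and ts: "two_squares (a ^ (n * p\<^sup>2) + 1)"
    and p: "prime p" "p mod 4 = 3"
  shows "p dvd a ^ n + 1"
proof (rule ccontr)
  assume nd: "\<not> p dvd a ^ n + 1"
  have "4 dvd a + 1" using a by presburger
  then have "4 dvd a ^ n + 1" using odd_power_plus_one_factor[OF n] by (metis dvd_mult2)
  then have "a ^ n mod 4 = 3" by presburger
  then obtain q where q: "prime q" "q mod 4 = 3" "p < q"
    "odd (multiplicity q ((a ^ n) ^ p + 1))"
    using ex_larger_prime_odd_multiplicity[OF _ p nd] by blast
  have "q dvd a ^ (n * p) + 1"
    using q(4) not_dvd_imp_multiplicity_0[of q "a ^ (n * p) + 1"] by (force simp: power_mult)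
  then have "multiplicity q (a ^ (n * p * p) + 1) = multiplicity q (a ^ (n * p) + 1) + multiplicity q p"
    using q p odd_if_mod_4 by (intro multiplicity_power_mult_plus_one) auto
  moreover have "multiplicity q p = 0"
    using q p primes_dvd_imp_eq[of q p] by (auto intro!: not_dvd_imp_multiplicity_0)
  moreover have "even (multiplicity q (a ^ (n * p * p) + 1))"
    using two_squares_even_multiplicity[OF q(1,2) ts] by (simp add: power2_eq_square mult.assoc)
  ultimately show False using q(4) by (simp add: power_mult)
qed

lemma two_squares_power_plus_one_divisor:
  fixes a d e :: nat
  assumes "odd (d * e)" "two_squares (a ^ (d * e) + 1)" "two_squares e"
  shows "two_squares (a ^ d + 1)"
proof (rule two_squares_if_even_multiplicity)
  fix q :: nat assume q: "prime q" "q mod 4 = 3"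
  show "even (multiplicity q (a ^ d + 1))"
  proof (cases "q dvd a ^ d + 1")
    case True
    then have "multiplicity q (a ^ (d * e) + 1) = multiplicity q (a ^ d + 1) + multiplicity q e"
      using q odd_if_mod_4 assms(1) by (intro multiplicity_power_mult_plus_one) auto
    then show ?thesis
      using two_squares_even_multiplicity[OF q assms(2)] two_squares_even_multiplicity[OF q assms(3)]
      by simp
  qed (simp add: not_dvd_imp_multiplicity_0)
qed simp

text \<open>
If \<open>d\<close> is a sum of two squares dividing \<open>m\<close>, then \<open>m div d\<close> also has a quotient that is a sum of two
squares, so minimality forces \<open>d = 1\<close>. With \<open>d = p\<^sup>2\<close> and with \<open>d = p\<close> for \<open>p\<close> not 3 modulo 4 this
shows that \<open>m\<close> is a product of distinct primes congruent to 3 modulo 4. Each of these has odd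
multiplicity in \<open>n\<close>, hence divides \<open>n\<close>.
\<close>

lemma least_two_squares_divisor_dvd:
  fixes N n m :: nat
  assumes N: "N > 0" and n: "n > 0"
    and m: "m = (LEAST k. k > 0 \<and> k dvd N \<and> two_squares (N div k))"
    and par: "\<And>q. prime q \<Longrightarrow> q mod 4 = 3 \<Longrightarrow>
      even (multiplicity q n) \<longleftrightarrow> even (multiplicity q N)"
  shows "m dvd n \<and> two_squares (n div m)"
proof -
  let ?P = "\<lambda>k. k > 0 \<and> k dvd N \<and> two_squares (N div k)"
  have "?P N" using N two_squares_square[of 1] by simp
  then have m0: "m > 0" and mN: "m dvd N" and mts: "two_squares (N div m)"
    unfolding m using LeastI[of ?P N] by blast+
  from mN obtain c where c: "N = m * c" by blast
  have cts: "two_squares c" using mts c m0 by simp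
  have c0: "c > 0" using c N by (cases c) auto
  have no_div: "d = 1" if d: "two_squares d" "d dvd m" for d
  proof -
    from d obtain k where k: "m = d * k" by blast
    have "k > 0" using k m0 by (cases k) auto
    moreover have "N = k * (d * c)" using c k by simp
    ultimately have "?P k" using two_squares_mult[OF d(1) cts] by simp
    then have "m \<le> k" unfolding m by (rule Least_le)
    then show ?thesis using k m0 by auto
  qed
  have par': "even (multiplicity q n) \<longleftrightarrow> even (multiplicity q m)" if q: "prime q" "q mod 4 = 3" for q
  proof -
    have "multiplicity q N = multiplicity q m + multiplicity q c"
      unfolding c using q m0 c0 by (intro prime_elem_multiplicity_mult_distrib) auto
    then show ?thesis using par[OF q] two_squares_even_multiplicity[OF q cts] by simp
  qed
  have "m dvd n"
  proof (rule multiplicity_le_imp_dvd)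
    show "m \<noteq> 0" using m0 by simp
    fix p :: nat assume p: "prime p"
    show "multiplicity p m \<le> multiplicity p n"
    proof (cases "p dvd m")
      case False
      then show ?thesis by (simp add: not_dvd_imp_multiplicity_0)
    next
      case True
      have "\<not> p\<^sup>2 dvd m"
        using no_div[of "p\<^sup>2"] two_squares_square[of p] prime_gt_1_nat[OF p] by auto
      then have le: "multiplicity p m \<le> 1" using multiplicity_dvd'[of 2 p m] by fastforce
      have "p mod 4 = 3"
      proof (rule ccontr)
        assume "p mod 4 \<noteq> 3"
        then have "even (multiplicity q p)" if "prime q" "q mod 4 = 3" for q
          using that p primes_dvd_imp_eq[of q p] not_dvd_imp_multiplicity_0[of q p] by force
        then have "two_squares p"
          using two_squares_if_even_multiplicity prime_gt_0_nat[OF p] by blast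
        then have "p = 1" using no_div True by blast
        then show False using p by simp
      qed
      moreover have "multiplicity p m = 1"
        using le True p m0 prime_multiplicity_gt_zero_iff[of p m] by simp
      ultimately have "odd (multiplicity p n)" using par'[OF p] by simp
      then show ?thesis using le by presburger
    qed
  qed
  moreover have "two_squares (n div m)"
  proof (rule two_squares_if_even_multiplicity)
    from \<open>m dvd n\<close> obtain e where e: "n = m * e" by blast
    show "n div m > 0" using \<open>m dvd n\<close> n m0 by (simp add: dvd_imp_le div_greater_zero_iff)
    fix q :: nat assume q: "prime q" "q mod 4 = 3"
    have "multiplicity q n = multiplicity q m + multiplicity q e"
      unfolding e using q m0 e n by (intro prime_elem_multiplicity_mult_distrib) auto
    moreover have "n div m = e" using e m0 by simp
    ultimately show "even (multiplicity q (n div m))" using par'[OF q] by auto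
  qed
  ultimately show ?thesis by blast
qed

theorem theorem1p7:
  fixes a m n :: nat
  assumes "a > 0" and "[a = 3] (mod 4)"
    and "m = (LEAST k. k > 0 \<and> sum_of_two_squares (of_nat (a + 1) / of_nat k))"
    and "n > 0" and "odd n"
    and "sum_of_two_squares (of_nat (a ^ n + 1))"
  shows "(sum_of_two_squares (of_nat n / of_nat m) \<and> m dvd n)
    \<and> sum_of_two_squares (of_nat (a ^ m + 1))
    \<and> (\<forall>\<delta>::nat. \<delta> > 0 \<and> \<delta> dvd n div m \<and> sum_of_two_squares (of_nat \<delta>)
          \<longrightarrow> sum_of_two_squares (of_nat (a ^ (m * \<delta>) + 1)))
    \<and> (\<forall>p::nat. prime p \<and> [p = 3] (mod 4)
          \<and> sum_of_two_squares (of_nat (a ^ (n * p\<^sup>2) + 1))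
          \<longrightarrow> p dvd a ^ n + 1)"
proof -
  have a: "a mod 4 = 3" using assms(2) by (simp add: cong_def)
  have ts: "two_squares (a ^ n + 1)" using assms(6) unfolding sum_of_two_squares_of_nat_iff .
  have m: "m = (LEAST k. k > 0 \<and> k dvd a + 1 \<and> two_squares ((a + 1) div k))"
    unfolding assms(3)
    by (rule arg_cong[of _ _ Least]) (use sum_of_two_squares_divide_iff in blast)
  have mn: "m dvd n" "two_squares (n div m)"
    using least_two_squares_divisor_dvd[OF _ assms(4) m] 
      multiplicity_exponent_parity[OF a assms(5) ts] by auto
  have m0: "m > 0" using mn(1) assms(4) by (cases m) auto
  have div: "two_squares (a ^ (m * \<delta>) + 1)" if "\<delta> dvd n div m" "two_squares \<delta>" for \<delta>
  proof -
    from that(1) obtain e where e: "n div m = \<delta> * e" by blast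
    then have n: "n = m * \<delta> * e" using mn(1) by (metis dvd_mult_div_cancel mult.assoc)
    have "two_squares e"
      using two_squares_cofactor[of \<delta> e] mn(2) that e n assms(4) by auto
    then show ?thesis
      using two_squares_power_plus_one_divisor[of "m * \<delta>" e a] ts assms(5) n by simp
  qed
  have "two_squares 1" using two_squares_square[of 1] by simp
  then have "two_squares (a ^ m + 1)" using div[of 1] by simp
  then show ?thesis
    unfolding sum_of_two_squares_of_nat_iff sum_of_two_squares_divide_iff[OF m0]
    using mn div dvd_if_prime_square[OF a assms(5)] by (auto simp: cong_def)
qed

end
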